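(* Let $f:(a,b)\to\mathbb{R}$ be a $\Phi$-convex function with $\Phi:[0,b-a]\to[0,\infty)$, and let $\varphi:(a,b)\to\mathbb{R}$ be a function such that $f(u)+(x-u)\varphi(u)\le f(x)+\Phi(|u-x|)$ for all $x,u\in(a,b)$. Let $x_1,\dots,x_n\in(a,b)$ and let $(a_1,\dots,a_n)$ be a nonnegative $n$-tuple with $A_n=\sum_{i=1}^n a_i>0$. Let $\overline{x}=\frac{1}{A_n}\sum_{i=1}^n a_ix_i$ and $\widehat{x}_i=(1-\lambda_i)\overline{x}+\lambda_ix_i$ with $\lambda_i\in[0,1]$, $i=1,\dots,n$. Then $$0\le\left|\frac{1}{A_n}\sum_{i=1}^n a_i\left|f(x_i)-f(\widehat{x}_i)+\Phi\big((1-\lambda_i)|\overline{x}-x_i|\big)\right|-\frac{1}{A_n}\sum_{i=1}^n a_i(1-\lambda_i)|\varphi(\widehat{x}_i)|\,|\overline{x}-x_i|\right|$$ $$\le\frac{1}{A_n}\sum_{i=1}^n a_if(x_i)-\frac{1}{A_n}\sum_{i=1}^n a_if(\widehat{x}_i)-\frac{1}{A_n}\sum_{i=1}^n a_i(1-\lambda_i)\varphi(\widehat{x}_i)(\overline{x}-x_i)+\sum_{i=1}^n a_i\Phi\big((1-\lambda_i)|\overline{x}-x_i|\big).$$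
   Context: A real function $f$ on an interval with endpoints $a<b$ is $\Phi$-convex, with error function $\Phi:[0,b-a]\to[0,\infty)$, if $tf(x)+(1-t)f(y)+t\Phi((1-t)|x-y|)+(1-t)\Phi(t|x-y|)\ge f(tx+(1-t)y)$ for all $x,y$ in the interval and all $t\in[0,1]$. It is known that for such $f$ a function $\varphi$ with $f(u)+(x-u)\varphi(u)\le f(x)+\Phi(|u-x|)$ for all $x,u$ exists.
   Formalization: In the last line the factor (x̄ − x_i) is replaced by (x_i − x̄), and the last sum Σ a_i Φ((1−λ_i)|x̄−x_i|) is multiplied by 1/A_n; as printed, either point makes the inequality false. *)

theory Defs
  imports Complex_Main
begin

(* The error function is only meaningful on {0..b - a}, where a < b are the endpoints of the
   interval I; it is a total function here, and its values outside that range are never used,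
   since all arguments below lie between 0 and \<bar>x - y\<bar>. *)
definition Phi_convex_on :: "real set \<Rightarrow> (real \<Rightarrow> real) \<Rightarrow> (real \<Rightarrow> real) \<Rightarrow> bool" where
  "Phi_convex_on I \<Phi> f \<longleftrightarrow>
     (\<forall>x\<in>I. \<forall>y\<in>I. \<forall>t\<in>{0..1}.
        t * f x + (1 - t) * f y + t * \<Phi> ((1 - t) * \<bar>x - y\<bar>) + (1 - t) * \<Phi> (t * \<bar>x - y\<bar>)
          \<ge> f (t * x + (1 - t) * y))"

end

theory Submission
  imports Defs "HOL-Analysis.Convex"
begin

text \<open>The support inequality at \<open>xhat i\<close> says that
  \<open>P = f (x i) - f (xhat i) + \<Phi> \<bar>x i - xhat i\<bar>\<close> is at least
  \<open>Q = \<phi> (xhat i) * (x i - xhat i)\<close>, where \<open>x i - xhat i = (1 - lam i) * (x i - xbar)\<close>.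
  Hence \<open>\<bar>\<bar>P\<bar> - \<bar>Q\<bar>\<bar> \<le> \<bar>P - Q\<bar> = P - Q\<close>, and averaging over \<open>i\<close> gives the bound.\<close>

lemma abs_weighted_sum_abs_diff_le:
  fixes w P Q :: "'a \<Rightarrow> real"
  assumes "\<And>i. i \<in> S \<Longrightarrow> 0 \<le> w i" and "\<And>i. i \<in> S \<Longrightarrow> Q i \<le> P i"
  shows "\<bar>(\<Sum>i\<in>S. w i * \<bar>P i\<bar>) - (\<Sum>i\<in>S. w i * \<bar>Q i\<bar>)\<bar> \<le> (\<Sum>i\<in>S. w i * P i) - (\<Sum>i\<in>S. w i * Q i)"
proof -
  have "\<bar>\<Sum>i\<in>S. w i * (\<bar>P i\<bar> - \<bar>Q i\<bar>)\<bar> \<le> (\<Sum>i\<in>S. w i * (P i - Q i))"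
  proof (rule order_trans[OF sum_abs sum_mono])
    fix i assume "i \<in> S"
    with assms show "\<bar>w i * (\<bar>P i\<bar> - \<bar>Q i\<bar>)\<bar> \<le> w i * (P i - Q i)"
      by (force simp: abs_mult intro!: mult_left_mono)
  qed
  then show ?thesis
    by (simp add: right_diff_distrib sum_subtractf)
qed

text \<open>The right-hand side is the weighted mean of \<open>P - Q\<close>, hence the factor
  \<open>x i - xbar\<close> and the \<open>1 / A\<close> on every sum. With
  \<open>xbar - x i\<close> it can be negative (\<open>f\<close> the identity,
  \<open>\<phi> = 1\<close>, \<open>\<Phi> = 0\<close>, suitable \<open>lam\<close>); without the
  last \<open>1 / A\<close> the bound fails for \<open>f = \<phi> = 0\<close>, constant
  \<open>\<Phi> > 0\<close> and \<open>A < 1\<close>.\<close>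

theorem theorem12:
  fixes a b :: real and f \<phi> \<Phi> :: "real \<Rightarrow> real"
    and n :: nat and x w lam xhat :: "nat \<Rightarrow> real" and A xbar :: real
  assumes "a < b"
    and "\<And>s. s \<in> {0..b - a} \<Longrightarrow> 0 \<le> \<Phi> s"
    and "Phi_convex_on {a<..<b} \<Phi> f"
    and "\<And>y u. y \<in> {a<..<b} \<Longrightarrow> u \<in> {a<..<b} \<Longrightarrow> f u + (y - u) * \<phi> u \<le> f y + \<Phi> \<bar>u - y\<bar>"
    and "\<And>i. i \<in> {1..n} \<Longrightarrow> x i \<in> {a<..<b}"
    and "\<And>i. i \<in> {1..n} \<Longrightarrow> 0 \<le> w i"
    and "A = (\<Sum>i=1..n. w i)" and "A > 0"
    and "xbar = (1 / A) * (\<Sum>i=1..n. w i * x i)"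
    and "\<And>i. i \<in> {1..n} \<Longrightarrow> lam i \<in> {0..1}"
    and "\<And>i. i \<in> {1..n} \<Longrightarrow> xhat i = (1 - lam i) * xbar + lam i * x i"
  shows "0 \<le> \<bar>(1 / A) * (\<Sum>i=1..n. w i * \<bar>f (x i) - f (xhat i) + \<Phi> ((1 - lam i) * \<bar>xbar - x i\<bar>)\<bar>)
              - (1 / A) * (\<Sum>i=1..n. w i * (1 - lam i) * \<bar>\<phi> (xhat i)\<bar> * \<bar>xbar - x i\<bar>)\<bar>
    \<and> \<bar>(1 / A) * (\<Sum>i=1..n. w i * \<bar>f (x i) - f (xhat i) + \<Phi> ((1 - lam i) * \<bar>xbar - x i\<bar>)\<bar>)
              - (1 / A) * (\<Sum>i=1..n. w i * (1 - lam i) * \<bar>\<phi> (xhat i)\<bar> * \<bar>xbar - x i\<bar>)\<bar>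
      \<le> (1 / A) * (\<Sum>i=1..n. w i * f (x i))
        - (1 / A) * (\<Sum>i=1..n. w i * f (xhat i))
        - (1 / A) * (\<Sum>i=1..n. w i * (1 - lam i) * \<phi> (xhat i) * (x i - xbar))
        + (1 / A) * (\<Sum>i=1..n. w i * \<Phi> ((1 - lam i) * \<bar>xbar - x i\<bar>))"
proof -
  define P where "P i = f (x i) - f (xhat i) + \<Phi> ((1 - lam i) * \<bar>xbar - x i\<bar>)" for i
  define Q where "Q i = (1 - lam i) * \<phi> (xhat i) * (x i - xbar)" for i
  \<comment> \<open>The weights \<open>w i / A\<close> sum to 1, so \<open>xbar\<close> is a convex
    combination of points of a convex set.\<close>
  have "(\<Sum>i=1..n. (w i / A) *\<^sub>R x i) \<in> {a<..<b}"
    using assms(5-8) by (intro convex_sum) (auto simp flip: sum_divide_distrib)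
  then have xbar: "xbar \<in> {a<..<b}"
    by (simp add: assms(9) sum_divide_distrib)
  have QP: "Q i \<le> P i" if i: "i \<in> {1..n}" for i
  proof -
    have lam: "0 \<le> lam i" "lam i \<le> 1"
      using assms(10)[OF i] by auto
    \<comment> \<open>\<open>xhat i\<close> lies on the segment from \<open>xbar\<close> to
      \<open>x i\<close>, so the support inequality is available at
      \<open>u = xhat i\<close>.\<close>
    have "xhat i \<in> {a<..<b}"
      using convexD_alt[OF _ xbar assms(5)[OF i] lam] by (simp add: assms(11)[OF i])
    note support = assms(4)[OF assms(5)[OF i] this]
    \<comment> \<open>This identity serves twice: its absolute value is the argument of
      \<open>\<Phi>\<close>, its negative the increment in \<open>Q i\<close>.\<close>
    have diff: "xhat i - x i = (1 - lam i) * (xbar - x i)"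
      by (simp add: assms(11)[OF i] algebra_simps)
    then have "\<bar>xhat i - x i\<bar> = (1 - lam i) * \<bar>xbar - x i\<bar>"
      using lam by (simp add: abs_mult)
    moreover have "(x i - xhat i) * \<phi> (xhat i) = Q i"
      unfolding Q_def using diff by algebra
    ultimately show ?thesis
      using support by (simp add: P_def)
  qed
  \<comment> \<open>Since \<open>lam i \<le> 1\<close>, the factor \<open>1 - lam i\<close> leaves
    the absolute value unchanged.\<close>
  have absQ: "(\<Sum>i=1..n. w i * \<bar>Q i\<bar>)
      = (\<Sum>i=1..n. w i * (1 - lam i) * \<bar>\<phi> (xhat i)\<bar> * \<bar>xbar - x i\<bar>)"
    using assms(10) by (intro sum.cong) (auto simp: Q_def abs_mult abs_minus_commute)
  \<comment> \<open>As \<open>A > 0\<close>, dividing by \<open>A\<close> commutes with the outer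
    absolute value.\<close>
  have "\<bar>(1 / A) * (\<Sum>i=1..n. w i * \<bar>P i\<bar>) - (1 / A) * (\<Sum>i=1..n. w i * \<bar>Q i\<bar>)\<bar>
      \<le> (1 / A) * ((\<Sum>i=1..n. w i * P i) - (\<Sum>i=1..n. w i * Q i))"
    using divide_right_mono[OF abs_weighted_sum_abs_diff_le[of "{1..n}" w Q P], of A] assms(6) QP \<open>A > 0\<close>
    by (simp flip: diff_divide_distrib)
  also have "\<dots> = (1 / A) * (\<Sum>i=1..n. w i * f (x i)) - (1 / A) * (\<Sum>i=1..n. w i * f (xhat i))
      - (1 / A) * (\<Sum>i=1..n. w i * (1 - lam i) * \<phi> (xhat i) * (x i - xbar))
      + (1 / A) * (\<Sum>i=1..n. w i * \<Phi> ((1 - lam i) * \<bar>xbar - x i\<bar>))"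
    by (simp add: P_def Q_def algebra_simps sum.distrib sum_subtractf diff_divide_distrib
        add_divide_distrib)
  finally show ?thesis
    unfolding absQ P_def by simp
qed

end
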